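(* Let $(a_n)_{n\ge 1}$ be a sequence of real numbers which converges to $0$. Set $$b_n=a_n-a_{n+1}\quad\text{and}\quad c_n=a_n-2a_{n+1}+a_{n+2}.$$ If the sequences $(a_n/n)_{n\ge 1}$, $(b_n)_{n\ge 1}$ and $(nc_n)_{n\ge 1}$ are all absolutely summable, then the matrix $$\left[\frac{(j-i)a_{i+j}}{i+j+1}\right]_{i,j\ge 1}$$ is a Schur multiplier.
   Context: The Schur product of two matrices $A=[a_{ij}]_{i,j\ge 1}$ and $B=[b_{ij}]_{i,j\ge 1}$ is the entrywise product $A\ast B=[a_{ij}b_{ij}]_{i,j\ge 1}$. Operators in $B(\ell_2)$ are identified with their matrices in the standard basis (indexed by $i,j\ge 1$). An infinite matrix $M$ of scalars is a Schur multiplier if $M\ast A\in B(\ell_2)$ for every $A\in B(\ell_2)$ and the map $\mathcal{S}_M:B(\ell_2)\to B(\ell_2)$, $\mathcal{S}_M(A)=M\ast A$, is bounded. *)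

theory Defs
  imports "HOL-Analysis.Analysis"
begin

text \<open>The complex Hilbert space \<open>\<ell>\<^sub>2\<close>. Its coordinates are indexed by the integers \<open>n \<ge> 1\<close>;
  the unused coordinate 0 is fixed to be 0.\<close>

typedef ell2 = "{x :: nat \<Rightarrow> complex. x 0 = 0 \<and> summable (\<lambda>n. (cmod (x n))\<^sup>2)}"
  morphisms coord Abs_ell2
  by (rule exI[of _ "\<lambda>_. 0"]) simp

setup_lifting type_definition_ell2

lemma coord_0 [simp]: "coord x 0 = 0"
  using coord[of x] by simp

lemma summable_coord: "summable (\<lambda>n. (cmod (coord x n))\<^sup>2)"
  using coord[of x] by simp

lemma sqrt_partial_le:
  assumes "summable (\<lambda>n. (cmod (f n))\<^sup>2)"
  shows "L2_set (\<lambda>n. cmod (f n)) {..<N} \<le> sqrt (\<Sum>n. (cmod (f n))\<^sup>2)"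
  unfolding L2_set_def using assms by (intro real_sqrt_le_mono sum_le_suminf) auto

lemma L2_set_add_le:
  assumes "summable (\<lambda>n. (cmod (f n))\<^sup>2)" "summable (\<lambda>n. (cmod (g n))\<^sup>2)"
  shows "L2_set (\<lambda>n. cmod (f n + g n)) {..<N} \<le>
           sqrt (\<Sum>n. (cmod (f n))\<^sup>2) + sqrt (\<Sum>n. (cmod (g n))\<^sup>2)"
proof -
  have "L2_set (\<lambda>n. cmod (f n + g n)) {..<N} \<le> L2_set (\<lambda>n. cmod (f n) + cmod (g n)) {..<N}"
    by (intro L2_set_mono) (auto simp: norm_triangle_ineq)
  also have "\<dots> \<le> L2_set (\<lambda>n. cmod (f n)) {..<N} + L2_set (\<lambda>n. cmod (g n)) {..<N}"
    by (rule L2_set_triangle_ineq)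
  also have "\<dots> \<le> sqrt (\<Sum>n. (cmod (f n))\<^sup>2) + sqrt (\<Sum>n. (cmod (g n))\<^sup>2)"
    using assms by (intro add_mono sqrt_partial_le)
  finally show ?thesis .
qed

lemma partial_sum_add_le:
  assumes "summable (\<lambda>n. (cmod (f n))\<^sup>2)" "summable (\<lambda>n. (cmod (g n))\<^sup>2)"
  shows "(\<Sum>n<N. (cmod (f n + g n))\<^sup>2) \<le>
           (sqrt (\<Sum>n. (cmod (f n))\<^sup>2) + sqrt (\<Sum>n. (cmod (g n))\<^sup>2))\<^sup>2"
  using power_mono[OF L2_set_add_le[OF assms, of N] L2_set_nonneg, of 2]
  by (simp add: L2_set_def sum_nonneg)

lemma summable_add_sq:
  assumes "summable (\<lambda>n. (cmod (f n))\<^sup>2)" "summable (\<lambda>n. (cmod (g n))\<^sup>2)"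
  shows "summable (\<lambda>n. (cmod (f n + g n))\<^sup>2)"
  by (rule summableI_nonneg_bounded) (use partial_sum_add_le[OF assms] in auto)

instantiation ell2 :: real_normed_vector
begin

lift_definition zero_ell2 :: ell2 is "\<lambda>_. 0" by simp
lift_definition plus_ell2 :: "ell2 \<Rightarrow> ell2 \<Rightarrow> ell2" is "\<lambda>x y n. x n + y n"
  by (simp add: summable_add_sq)
lift_definition uminus_ell2 :: "ell2 \<Rightarrow> ell2" is "\<lambda>x n. - x n" by simp
lift_definition minus_ell2 :: "ell2 \<Rightarrow> ell2 \<Rightarrow> ell2" is "\<lambda>x y n. x n - y n"
  using summable_add_sq[of _ "\<lambda>n. - _ n"] by simp
lift_definition scaleR_ell2 :: "real \<Rightarrow> ell2 \<Rightarrow> ell2" is "\<lambda>r x n. r *\<^sub>R x n"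
  by (simp add: power_mult_distrib)

definition norm_ell2 :: "ell2 \<Rightarrow> real"
  where "norm_ell2 x = sqrt (\<Sum>n. (cmod (coord x n))\<^sup>2)"
definition sgn_ell2 :: "ell2 \<Rightarrow> ell2" where "sgn_ell2 x = inverse (norm x) *\<^sub>R x"
definition dist_ell2 :: "ell2 \<Rightarrow> ell2 \<Rightarrow> real" where "dist_ell2 x y = norm (x - y)"
definition uniformity_ell2 :: "(ell2 \<times> ell2) filter"
  where "uniformity_ell2 = (INF e\<in>{0<..}. principal {(x, y). dist x y < e})"
definition open_ell2 :: "ell2 set \<Rightarrow> bool"
  where "open_ell2 U = (\<forall>x\<in>U. eventually (\<lambda>(x', y). x' = x \<longrightarrow> y \<in> U) uniformity)"

instance
proof
  fix x y z :: ell2 and r s :: real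
  show "x + y + z = x + (y + z)" by transfer (simp add: add.assoc)
  show "x + y = y + x" by transfer (simp add: add.commute)
  show "0 + x = x" by transfer simp
  show "- x + x = 0" by transfer simp
  show "x - y = x + - y" by transfer simp
  show "r *\<^sub>R (x + y) = r *\<^sub>R x + r *\<^sub>R y" by transfer (simp add: algebra_simps)
  show "(r + s) *\<^sub>R x = r *\<^sub>R x + s *\<^sub>R x" by transfer (simp add: algebra_simps)
  show "r *\<^sub>R s *\<^sub>R x = (r * s) *\<^sub>R x" by transfer simp
  show "1 *\<^sub>R x = x" by transfer simp
  show "sgn x = inverse (norm x) *\<^sub>R x" by (rule sgn_ell2_def)
  show "dist x y = norm (x - y)" by (rule dist_ell2_def)
  show "(uniformity :: (ell2 \<times> ell2) filter) = (INF e\<in>{0<..}. principal {(x, y). dist x y < e})"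
    by (rule uniformity_ell2_def)
  show "open U = (\<forall>x\<in>U. eventually (\<lambda>(x', y). x' = x \<longrightarrow> y \<in> U) uniformity)" for U :: "ell2 set"
    by (rule open_ell2_def)
  show "(norm x = 0) = (x = 0)"
    unfolding norm_ell2_def
    using suminf_eq_zero_iff[OF summable_coord[of x]]
    by (auto simp: coord_inject[symmetric] zero_ell2.rep_eq fun_eq_iff)
  show "norm (x + y) \<le> norm x + norm y"
    unfolding norm_ell2_def plus_ell2.rep_eq
    by (intro real_le_lsqrt suminf_le_const summable_add_sq summable_coord
          partial_sum_add_le add_nonneg_nonneg real_sqrt_ge_zero suminf_nonneg) auto
  show "norm (r *\<^sub>R x) = \<bar>r\<bar> * norm x"
    unfolding norm_ell2_def scaleR_ell2.rep_eq
    by (simp add: power_mult_distrib suminf_mult summable_coord real_sqrt_mult)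
qed

end

lift_definition scaleC_ell2 :: "complex \<Rightarrow> ell2 \<Rightarrow> ell2" is "\<lambda>c x n. c * x n"
  by (simp add: norm_mult power_mult_distrib)

interpretation ell2: vector_space scaleC_ell2
  by unfold_locales (transfer, simp add: algebra_simps)+

text \<open>The standard basis \<open>e\<^sub>j\<close>, \<open>j \<ge> 1\<close> (with the dummy value \<open>e\<^sub>0 = 0\<close>).\<close>

lift_definition basis_ell2 :: "nat \<Rightarrow> ell2" is "\<lambda>j i. if i = j \<and> j \<ge> 1 then 1 else 0"
proof -
  fix j :: nat
  have "summable (\<lambda>n. (cmod (if n = j \<and> j \<ge> 1 then 1 else 0))\<^sup>2)"
    by (rule summable_finite[of "{j}"]) auto
  then show "(if 0 = j \<and> j \<ge> 1 then 1 else 0 :: complex) = 0 \<and>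
      summable (\<lambda>n. (cmod (if n = j \<and> j \<ge> 1 then 1 else 0))\<^sup>2)"
    by auto
qed

text \<open>\<open>B(\<ell>\<^sub>2)\<close>. The library predicate \<^const>\<open>bounded_linear\<close> only asks for real linearity, so
  complex linearity is required separately. The norm on \<open>B(\<ell>\<^sub>2)\<close> is \<^const>\<open>onorm\<close>.\<close>

definition bounded_ops :: "(ell2 \<Rightarrow> ell2) set"
  where "bounded_ops = {T. bounded_linear T \<and> Vector_Spaces.linear scaleC_ell2 scaleC_ell2 T}"

text \<open>Infinite matrices are functions \<open>nat \<Rightarrow> nat \<Rightarrow> complex\<close> of which only the entries with
  \<open>i, j \<ge> 1\<close> are meaningful.\<close>

definition matrix_of :: "(ell2 \<Rightarrow> ell2) \<Rightarrow> nat \<Rightarrow> nat \<Rightarrow> complex"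
  where "matrix_of T i j = coord (T (basis_ell2 j)) i"

definition has_matrix :: "(ell2 \<Rightarrow> ell2) \<Rightarrow> (nat \<Rightarrow> nat \<Rightarrow> complex) \<Rightarrow> bool"
  where "has_matrix T A \<longleftrightarrow> (\<forall>i\<ge>1. \<forall>j\<ge>1. matrix_of T i j = A i j)"

lemma coord_sum: "coord (\<Sum>i\<in>I. f i) n = (\<Sum>i\<in>I. coord (f i) n)"
  by (induction I rule: infinite_finite_induct)
    (simp_all add: zero_ell2.rep_eq plus_ell2.rep_eq)

lemma basis_expansion:
  "(\<lambda>N. \<Sum>j<N. scaleC_ell2 (coord x j) (basis_ell2 j)) \<longlonglongrightarrow> x"
proof -
  define p where "p N = (\<Sum>j<N. scaleC_ell2 (coord x j) (basis_ell2 j))" for N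
  have p: "coord (p N) n = (if n < N then coord x n else 0)" for N n
  proof -
    have "coord (p N) n = (\<Sum>j<N. if j = n then coord x n else 0)"
      unfolding p_def coord_sum
      by (rule sum.cong) (auto simp: scaleC_ell2.rep_eq basis_ell2.rep_eq Suc_le_eq)
    then show ?thesis by simp
  qed
  let ?s = "\<lambda>n. (cmod (coord x n))\<^sup>2"
  have nrm: "norm (x - p N) = sqrt (suminf ?s - (\<Sum>n<N. ?s n))" for N
  proof -
    have "(\<lambda>n. ?s n - (if n < N then ?s n else 0)) sums (suminf ?s - (\<Sum>n<N. ?s n))"
      using sums_If_finite_set[of "{..<N}" ?s]
      by (intro sums_diff summable_sums summable_coord) simp
    also have "(\<lambda>n. ?s n - (if n < N then ?s n else 0)) = (\<lambda>n. (cmod (coord (x - p N) n))\<^sup>2)"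
      by (auto simp: minus_ell2.rep_eq p)
    finally show ?thesis by (simp add: norm_ell2_def sums_iff)
  qed
  have "(\<lambda>N. sqrt (suminf ?s - (\<Sum>n<N. ?s n))) \<longlonglongrightarrow> sqrt (suminf ?s - suminf ?s)"
    by (intro tendsto_intros summable_LIMSEQ summable_coord)
  then have "(\<lambda>N. norm (x - p N)) \<longlonglongrightarrow> 0" by (simp add: nrm)
  then have "p \<longlonglongrightarrow> x"
    by (subst LIM_zero_iff[symmetric], subst tendsto_norm_zero_iff[symmetric])
      (simp add: norm_minus_commute)
  then show ?thesis unfolding p_def .
qed

lemma bounded_ops_eqI:
  assumes T: "T \<in> bounded_ops" "has_matrix T A" and S: "S \<in> bounded_ops" "has_matrix S A"
  shows "T = S"
proof
  fix x
  have e0: "basis_ell2 0 = 0"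
    by (simp add: coord_inject[symmetric] basis_ell2.rep_eq zero_ell2.rep_eq fun_eq_iff)
  have lim: "(\<lambda>N. \<Sum>j<N. scaleC_ell2 (coord x j) (R (basis_ell2 j))) \<longlonglongrightarrow> R x"
    if "R \<in> bounded_ops" for R
  proof -
    interpret R: Vector_Spaces.linear scaleC_ell2 scaleC_ell2 R
      using that by (simp add: bounded_ops_def)
    have "bounded_linear R" using that by (simp add: bounded_ops_def)
    from bounded_linear.tendsto[OF this basis_expansion[of x]]
    show ?thesis by (simp add: R.sum R.scale)
  qed
  have "T (basis_ell2 j) = S (basis_ell2 j)" for j
  proof (cases "j = 0")
    case True
    then show ?thesis
      using T(1) S(1) by (simp add: e0 bounded_ops_def linear_0 bounded_linear.linear)
  next
    case False
    have "coord (T (basis_ell2 j)) i = coord (S (basis_ell2 j)) i" for i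
      using False T(2) S(2) by (cases "i = 0") (simp_all add: has_matrix_def matrix_of_def)
    then show ?thesis by (simp add: coord_inject[symmetric] fun_eq_iff)
  qed
  then show "T x = S x"
    using LIMSEQ_unique[OF lim[OF T(1)]] lim[OF S(1)] by simp
qed

definition schur_product ::
    "(nat \<Rightarrow> nat \<Rightarrow> complex) \<Rightarrow> (nat \<Rightarrow> nat \<Rightarrow> complex) \<Rightarrow> nat \<Rightarrow> nat \<Rightarrow> complex"
  where "schur_product A B i j = A i j * B i j"

text \<open>An operator in \<open>B(\<ell>\<^sub>2)\<close> is determined by its matrix (\<open>bounded_ops_eqI\<close>), so the operator \<open>S\<close> with matrix
  \<open>M * T\<close> is unique. The first conjunct says that \<open>T \<mapsto> M * T\<close> maps \<open>B(\<ell>\<^sub>2)\<close> to itself,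
  the second that this map is bounded.\<close>

definition schur_multiplier :: "(nat \<Rightarrow> nat \<Rightarrow> complex) \<Rightarrow> bool"
  where "schur_multiplier M \<longleftrightarrow>
    (\<forall>T\<in>bounded_ops. \<exists>S\<in>bounded_ops. has_matrix S (schur_product M (matrix_of T))) \<and>
    (\<exists>C. \<forall>T\<in>bounded_ops. \<forall>S\<in>bounded_ops.
       has_matrix S (schur_product M (matrix_of T)) \<longrightarrow> onorm S \<le> C * onorm T)"

end

theory Submission
  imports Defs
begin

text \<open>
  Put \<open>d\<^sub>n = a\<^sub>n / (n + 1)\<close>, so that the matrix is \<open>[(j - i) d\<^sub>i\<^sub>+\<^sub>j]\<close>, and let \<open>e\<^sub>n\<close> be the second
  difference \<open>d\<^sub>n - 2 d\<^sub>n\<^sub>+\<^sub>1 + d\<^sub>n\<^sub>+\<^sub>2\<close>. The product rule for differences splits \<open>e\<^sub>n\<close> into pieces of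
  order \<open>a\<^sub>n / n\<^sup>3\<close>, \<open>b\<^sub>n / n\<^sup>2\<close> and \<open>c\<^sub>n / n\<close>, so the three summability hypotheses together say
  that \<open>\<Sum> n\<^sup>2 \<bar>e\<^sub>n\<bar> < \<infinity>\<close> (\<open>second_difference_quotient_le\<close>).

  Since \<open>n d\<^sub>n \<rightarrow> 0\<close>, summing twice by parts recovers \<open>d\<close> from its second difference as a
  superposition of ramps: \<open>d\<^sub>n = \<Sum>m. e\<^sub>m (m + 1 - n)\<^sub>+\<close> (\<open>sum_second_difference_tendsto\<close>). A ramp evaluated
  at \<open>i + j\<close> counts the integers \<open>t\<close> with \<open>i < t \<le> m + 1 - j\<close>; it is therefore a sum of at most
  \<open>m\<close> rank one matrices \<open>u(i) v(j)\<close> with entries 0 and 1, which vanish unless \<open>i, j \<le> m\<close>.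
  Multiplying by \<open>j\<close> or by \<open>i\<close> then costs a factor \<open>m\<close>, and \<open>(j - i) (m + 1 - (i + j))\<^sub>+\<close> is a
  Schur multiplier of norm at most \<open>2 m\<^sup>2\<close> (\<open>schur_norm_le_weighted_ramp\<close>).

  The Schur product with \<open>u(i) v(j)\<close> is \<open>T \<mapsto> U T V\<close> for diagonal contractions \<open>U\<close> and \<open>V\<close>,
  so the Schur norm of such a matrix is at most 1, and everything else is the triangle inequality.
  The infinite superposition is handled by \<open>schur_norm_le_limit\<close>: the Schur norm does not increase
  under entrywise limits.
\<close>

section \<open>Bounded operators on \<open>\<ell>\<^sub>2\<close>\<close>

lemma norm_coord_le: "cmod (coord x n) \<le> norm x"
proof -
  have "(cmod (coord x n))\<^sup>2 \<le> (\<Sum>k. (cmod (coord x k))\<^sup>2)"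
    using sum_le_suminf[OF summable_coord, of "{n}" x] by simp
  then show ?thesis
    unfolding norm_ell2_def by (rule real_le_rsqrt)
qed

lemma norm_sq_eq: "(norm x)\<^sup>2 = (\<Sum>n. (cmod (coord x n))\<^sup>2)" for x :: ell2
  unfolding norm_ell2_def by (simp add: suminf_nonneg summable_coord)

lemma partial_sum_le_norm_sq: "(\<Sum>n<N. (cmod (coord x n))\<^sup>2) \<le> (norm x)\<^sup>2"
  unfolding norm_sq_eq by (intro sum_le_suminf summable_coord) auto

lemma ell2_eqI: "(\<And>n. coord x n = coord y n) \<Longrightarrow> x = y"
  by (simp add: coord_inject[symmetric] fun_eq_iff)

text \<open>Vectors are constructed by bounding finite sections only, so that no infinite sum has to be
  manipulated when an operator is defined coordinatewise.\<close>

lemma ell2_of_bounded_partial_sums: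
  assumes "z 0 = 0" and le: "\<And>N. (\<Sum>n<N. (cmod (z n))\<^sup>2) \<le> K\<^sup>2" and "0 \<le> K"
  obtains x where "coord x = z" "norm x \<le> K"
proof
  have s: "summable (\<lambda>n. (cmod (z n))\<^sup>2)"
    by (rule summableI_nonneg_bounded) (use le in auto)
  then show c: "coord (Abs_ell2 z) = z"
    using assms(1) by (simp add: Abs_ell2_inverse)
  show "norm (Abs_ell2 z) \<le> K"
    unfolding norm_ell2_def c
    by (rule real_le_lsqrt) (use s le assms(3) in \<open>auto intro: suminf_le_const suminf_nonneg\<close>)
qed

lemma scaleR_eq_scaleC: "r *\<^sub>R x = scaleC_ell2 (complex_of_real r) x"
  by transfer (simp add: scaleR_conv_of_real)

lemma norm_scaleC: "norm (scaleC_ell2 l x) = cmod l * norm x"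
  unfolding norm_ell2_def scaleC_ell2.rep_eq
  by (simp add: norm_mult power_mult_distrib suminf_mult summable_coord real_sqrt_mult)

lemma bounded_opsI:
  assumes add: "\<And>x y. T (x + y) = T x + T y"
    and scale: "\<And>l x. T (scaleC_ell2 l x) = scaleC_ell2 l (T x)"
    and le: "\<And>x. norm (T x) \<le> K * norm x"
  shows "T \<in> bounded_ops"
proof -
  have "bounded_linear T"
    by (rule bounded_linear_intro[of _ K])
      (simp_all add: add scale scaleR_eq_scaleC le mult.commute)
  moreover have "Vector_Spaces.linear scaleC_ell2 scaleC_ell2 T"
    by unfold_locales (simp_all add: add scale)
  ultimately show ?thesis by (simp add: bounded_ops_def)
qed

lemma bounded_ops_add: "T \<in> bounded_ops \<Longrightarrow> T (x + y) = T x + T y"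
  unfolding bounded_ops_def by (auto simp: bounded_linear.linear linear_add)

lemma bounded_ops_scale: "T \<in> bounded_ops \<Longrightarrow> T (scaleC_ell2 l x) = scaleC_ell2 l (T x)"
proof -
  assume "T \<in> bounded_ops"
  then interpret T: Vector_Spaces.linear scaleC_ell2 scaleC_ell2 T
    by (simp add: bounded_ops_def)
  show ?thesis by (rule T.scale)
qed

lemma bounded_ops_diff: "T \<in> bounded_ops \<Longrightarrow> T (x - y) = T x - T y"
  unfolding bounded_ops_def by (auto simp: bounded_linear.linear linear_diff)

lemma bounded_ops_sum: "T \<in> bounded_ops \<Longrightarrow> T (\<Sum>i\<in>I. f i) = (\<Sum>i\<in>I. T (f i))"
  unfolding bounded_ops_def by (auto simp: bounded_linear.linear linear_sum)

lemma bounded_ops_onorm: "T \<in> bounded_ops \<Longrightarrow> norm (T x) \<le> onorm T * norm x"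
  unfolding bounded_ops_def by (auto intro: onorm)

lemma bounded_ops_onorm_nonneg: "T \<in> bounded_ops \<Longrightarrow> 0 \<le> onorm T"
  unfolding bounded_ops_def by (auto intro: onorm_pos_le)

lemma diagonal_operator:
  assumes "\<And>n. cmod (w n) \<le> 1"
  obtains D where "\<And>x n. coord (D x) n = w n * coord x n" "\<And>x. norm (D x) \<le> norm x"
    "D \<in> bounded_ops"
proof -
  have "\<exists>y. coord y = (\<lambda>n. w n * coord x n) \<and> norm y \<le> norm x" for x
  proof -
    have "(\<Sum>n<N. (cmod (w n * coord x n))\<^sup>2) \<le> (norm x)\<^sup>2" for N
    proof -
      have "(\<Sum>n<N. (cmod (w n * coord x n))\<^sup>2) \<le> (\<Sum>n<N. (cmod (coord x n))\<^sup>2)"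
        using assms by (intro sum_mono power_mono) (auto simp: norm_mult mult_left_le_one_le)
      then show ?thesis using partial_sum_le_norm_sq[of x N] by linarith
    qed
    then show ?thesis
      using ell2_of_bounded_partial_sums[of "\<lambda>n. w n * coord x n" "norm x"] by auto
  qed
  then obtain D where D: "\<And>x. coord (D x) = (\<lambda>n. w n * coord x n)" "\<And>x. norm (D x) \<le> norm x"
    by metis
  have "D \<in> bounded_ops"
    by (rule bounded_opsI[of _ 1])
      (auto intro!: ell2_eqI simp: D plus_ell2.rep_eq scaleC_ell2.rep_eq algebra_simps)
  with D show thesis by (intro that) auto
qed

text \<open>Uniformly bounded operators whose matrix entries converge have a limit in the weak operator
  topology. Each coordinate of \<open>S\<^sub>N x\<close> converges for \<open>x\<close> in the span of the basis, hence, by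
  density and the uniform bound, for all \<open>x\<close>; the bound passes to the limit because it can be read
  off from finitely many coordinates at a time.\<close>

lemma pointwise_limit_operator:
  assumes S: "\<And>N. S N \<in> bounded_ops" and le: "\<And>N. onorm (S N) \<le> B"
    and lim: "\<And>i j. i \<ge> 1 \<Longrightarrow> j \<ge> 1 \<Longrightarrow> (\<lambda>N. matrix_of (S N) i j) \<longlonglongrightarrow> A i j"
  obtains R where "R \<in> bounded_ops" "has_matrix R A" "onorm R \<le> B"
proof -
  have B0: "0 \<le> B"
    using bounded_ops_onorm_nonneg[OF S[of 0]] le[of 0] by linarith
  have bnd: "norm (S N x) \<le> B * norm x" for N x
    using bounded_ops_onorm[OF S[of N], of x] mult_right_mono[OF le[of N] norm_ge_zero[of x]]
    by linarith
  \<comment> \<open>Row 0 and the dummy vector \<open>e\<^sub>0 = 0\<close> are not covered by \<open>lim\<close>.\<close>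
  have conv_basis: "convergent (\<lambda>N. coord (S N (basis_ell2 j)) i)" for i j
  proof (cases "i = 0 \<or> j = 0")
    case True
    have "coord (S N (basis_ell2 0)) i = 0" for N i
    proof -
      have "basis_ell2 0 = 0"
        by (rule ell2_eqI) (simp add: basis_ell2.rep_eq zero_ell2.rep_eq)
      then have "norm (S N (basis_ell2 0)) \<le> 0" using bnd[of N 0] by simp
      then show ?thesis by (simp add: zero_ell2.rep_eq)
    qed
    with True show ?thesis by (auto intro: convergent_const)
  next
    case False
    then show ?thesis
      using lim[of i j] by (auto simp: matrix_of_def convergent_def Suc_le_eq)
  qed
  \<comment> \<open>Approximate \<open>x\<close> by a finite section \<open>p\<close> of its basis expansion, uniformly in \<open>N\<close>.
    The denominator \<open>B + 1\<close> covers the case \<open>B = 0\<close>.\<close>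
  have conv: "convergent (\<lambda>N. coord (S N x) i)" for x i
  proof (rule Cauchy_convergent, rule metric_CauchyI)
    fix e :: real assume "0 < e"
    define d where "d = e / 3 / (B + 1)"
    have d0: "0 < d" using \<open>0 < e\<close> B0 by (simp add: d_def)
    have dB: "B * d < e / 3"
    proof -
      have "B * d < (B + 1) * d" using d0 by simp
      also have "\<dots> = e / 3" using B0 unfolding d_def by (subst nonzero_mult_div_cancel_left[symmetric, of "B + 1"]) auto
      finally show ?thesis .
    qed
    obtain J where J: "norm ((\<Sum>j<J. scaleC_ell2 (coord x j) (basis_ell2 j)) - x) < d"
      using LIMSEQ_D[OF basis_expansion[of x] d0] by blast
    define p where "p = (\<Sum>j<J. scaleC_ell2 (coord x j) (basis_ell2 j))"
    have "coord (S N p) i = (\<Sum>j<J. coord x j * coord (S N (basis_ell2 j)) i)" for N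
      by (simp add: p_def bounded_ops_sum[OF S] bounded_ops_scale[OF S] coord_sum
          scaleC_ell2.rep_eq)
    then have conv_p: "convergent (\<lambda>N. coord (S N p) i)"
      by (auto intro!: convergent_sum convergent_mult conv_basis convergent_const)
    then obtain N0 where
      N0: "dist (coord (S m p) i) (coord (S n p) i) < e / 3" if "m \<ge> N0" "n \<ge> N0" for m n
      using metric_CauchyD[OF convergent_Cauchy[OF conv_p], of "e / 3"] \<open>0 < e\<close> by auto
    have near: "dist (coord (S n x) i) (coord (S n p) i) < e / 3" for n
    proof -
      have "dist (coord (S n x) i) (coord (S n p) i) = cmod (coord (S n (x - p)) i)"
        by (simp add: dist_norm bounded_ops_diff[OF S] minus_ell2.rep_eq)
      also have "\<dots> \<le> B * norm (x - p)"
        using norm_coord_le bnd order_trans by blast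
      also have "\<dots> \<le> B * d"
        using J B0 by (intro mult_left_mono) (simp_all add: p_def norm_minus_commute)
      finally show ?thesis using dB by linarith
    qed
    show "\<exists>M. \<forall>m\<ge>M. \<forall>n\<ge>M. dist (coord (S m x) i) (coord (S n x) i) < e"
    proof (intro exI allI impI)
      fix m n assume "N0 \<le> m" "N0 \<le> n"
      then show "dist (coord (S m x) i) (coord (S n x) i) < e"
        using N0[of m n] near[of m] near[of n]
          dist_triangle[of "coord (S m x) i" "coord (S n x) i" "coord (S m p) i"]
          dist_triangle[of "coord (S m p) i" "coord (S n x) i" "coord (S n p) i"]
        by (simp add: dist_commute)
    qed
  qed
  define z where "z x i = lim (\<lambda>N. coord (S N x) i)" for x i
  have z: "(\<lambda>N. coord (S N x) i) \<longlonglongrightarrow> z x i" for x i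
    using conv[of x i] by (simp add: z_def convergent_LIMSEQ_iff)
  have "\<exists>y. coord y = z x \<and> norm y \<le> B * norm x" for x
  proof -
    have "(\<Sum>n<I. (cmod (z x n))\<^sup>2) \<le> (B * norm x)\<^sup>2" for I
    proof (rule LIMSEQ_le_const2)
      show "(\<lambda>N. \<Sum>n<I. (cmod (coord (S N x) n))\<^sup>2) \<longlonglongrightarrow> (\<Sum>n<I. (cmod (z x n))\<^sup>2)"
        by (intro tendsto_intros z)
      have "(\<Sum>n<I. (cmod (coord (S N x) n))\<^sup>2) \<le> (B * norm x)\<^sup>2" for N
        using partial_sum_le_norm_sq[of "S N x" I] power_mono[OF bnd[of N x] norm_ge_zero, of 2]
        by linarith
      then show "\<exists>N. \<forall>n\<ge>N. (\<Sum>k<I. (cmod (coord (S n x) k))\<^sup>2) \<le> (B * norm x)\<^sup>2"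
        by blast
    qed
    moreover have "z x 0 = 0" by (simp add: z_def)
    ultimately show ?thesis
      using ell2_of_bounded_partial_sums[of "z x" "B * norm x"] B0 by auto
  qed
  then obtain R where R: "\<And>x. coord (R x) = z x" "\<And>x. norm (R x) \<le> B * norm x"
    by metis
  have "R \<in> bounded_ops"
  proof (rule bounded_opsI[OF _ _ R(2)])
    show "R (x + y) = R x + R y" for x y
    proof (rule ell2_eqI)
      fix n
      have "(\<lambda>N. coord (S N (x + y)) n) \<longlonglongrightarrow> z x n + z y n"
        unfolding bounded_ops_add[OF S] plus_ell2.rep_eq by (intro tendsto_intros z)
      then show "coord (R (x + y)) n = coord (R x + R y) n"
        using z LIMSEQ_unique by (simp add: R plus_ell2.rep_eq) blast
    qed
    show "R (scaleC_ell2 l x) = scaleC_ell2 l (R x)" for l x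
    proof (rule ell2_eqI)
      fix n
      have "(\<lambda>N. coord (S N (scaleC_ell2 l x)) n) \<longlonglongrightarrow> l * z x n"
        unfolding bounded_ops_scale[OF S] scaleC_ell2.rep_eq by (intro tendsto_intros z)
      then show "coord (R (scaleC_ell2 l x)) n = coord (scaleC_ell2 l (R x)) n"
        using z LIMSEQ_unique by (simp add: R scaleC_ell2.rep_eq) blast
    qed
  qed
  moreover have "has_matrix R A"
    unfolding has_matrix_def
  proof (intro allI impI)
    fix i j :: nat assume "1 \<le> i" "1 \<le> j"
    then show "matrix_of R i j = A i j"
      using LIMSEQ_unique[OF z lim[unfolded matrix_of_def]] by (simp add: matrix_of_def R)
  qed
  moreover have "onorm R \<le> B"
    by (rule onorm_bound[OF B0 R(2)])
  ultimately show thesis by (rule that)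
qed

section \<open>Schur multipliers of bounded norm\<close>

text \<open>The norm of \<open>T \<mapsto> M * T\<close> is at most \<open>C\<close>. Phrasing this as a relation carries existence of the
  product operator and its bound together through sums and limits.\<close>

definition schur_norm_le :: "(nat \<Rightarrow> nat \<Rightarrow> complex) \<Rightarrow> real \<Rightarrow> bool"
  where "schur_norm_le M C \<longleftrightarrow>
    (\<forall>T\<in>bounded_ops. \<exists>S\<in>bounded_ops.
       has_matrix S (schur_product M (matrix_of T)) \<and> onorm S \<le> C * onorm T)"

lemma schur_norm_le_imp_multiplier: "schur_norm_le M C \<Longrightarrow> schur_multiplier M"
  unfolding schur_norm_le_def schur_multiplier_def by (blast dest: bounded_ops_eqI)

lemma schur_norm_le_cong:
  assumes "schur_norm_le M C" "\<And>i j. i \<ge> 1 \<Longrightarrow> j \<ge> 1 \<Longrightarrow> M i j = M' i j"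
  shows "schur_norm_le M' C"
  using assms unfolding schur_norm_le_def has_matrix_def schur_product_def by fastforce

lemma schur_norm_le_mono: "schur_norm_le M C \<Longrightarrow> C \<le> C' \<Longrightarrow> schur_norm_le M C'"
  unfolding schur_norm_le_def
  by (meson bounded_ops_onorm_nonneg mult_right_mono order_trans)

text \<open>The Schur product with \<open>u(i) v(j)\<close> multiplies \<open>T\<close> on both sides by diagonal contractions.\<close>

lemma schur_norm_le_rank_one:
  assumes "\<And>i. cmod (u i) \<le> 1" "\<And>j. cmod (v j) \<le> 1"
  shows "schur_norm_le (\<lambda>i j. u i * v j) 1"
  unfolding schur_norm_le_def
proof
  fix T assume T: "T \<in> bounded_ops"
  obtain U where U: "\<And>x n. coord (U x) n = u n * coord x n" "\<And>x. norm (U x) \<le> norm x"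
    "U \<in> bounded_ops" by (rule diagonal_operator[of u, OF assms(1)]) blast
  obtain V where V: "\<And>x n. coord (V x) n = v n * coord x n" "\<And>x. norm (V x) \<le> norm x"
    "V \<in> bounded_ops" by (rule diagonal_operator[of v, OF assms(2)]) blast
  let ?S = "\<lambda>x. U (T (V x))"
  have le: "norm (?S x) \<le> onorm T * norm x" for x
    using U(2)[of "T (V x)"] bounded_ops_onorm[OF T, of "V x"]
      mult_left_mono[OF V(2)[of x] bounded_ops_onorm_nonneg[OF T]] by linarith
  have "?S \<in> bounded_ops"
    using T U(3) V(3) by (intro bounded_opsI[OF _ _ le]) (simp_all add: bounded_ops_add bounded_ops_scale)
  moreover have "has_matrix ?S (schur_product (\<lambda>i j. u i * v j) (matrix_of T))"
  proof -
    have "V (basis_ell2 j) = scaleC_ell2 (v j) (basis_ell2 j)" for j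
      by (rule ell2_eqI) (simp add: V scaleC_ell2.rep_eq basis_ell2.rep_eq)
    then show ?thesis
      by (simp add: has_matrix_def matrix_of_def schur_product_def U bounded_ops_scale[OF T]
          scaleC_ell2.rep_eq)
  qed
  moreover have "onorm ?S \<le> 1 * onorm T"
    using onorm_bound[OF bounded_ops_onorm_nonneg[OF T] le] by simp
  ultimately show "\<exists>S\<in>bounded_ops.
      has_matrix S (schur_product (\<lambda>i j. u i * v j) (matrix_of T)) \<and> onorm S \<le> 1 * onorm T"
    by blast
qed

lemma schur_norm_le_scale:
  assumes "schur_norm_le M C"
  shows "schur_norm_le (\<lambda>i j. l * M i j) (cmod l * C)"
  unfolding schur_norm_le_def
proof
  fix T assume T: "T \<in> bounded_ops"
  with assms obtain S where S: "S \<in> bounded_ops" "has_matrix S (schur_product M (matrix_of T))"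
    "onorm S \<le> C * onorm T" unfolding schur_norm_le_def by blast
  let ?S = "\<lambda>x. scaleC_ell2 l (S x)"
  have le: "norm (?S x) \<le> (cmod l * onorm S) * norm x" for x
    using mult_left_mono[OF bounded_ops_onorm[OF S(1), of x] norm_ge_zero[of l]]
    by (simp add: norm_scaleC mult.assoc)
  have "?S \<in> bounded_ops"
    using S(1) by (intro bounded_opsI[OF _ _ le])
      (simp_all add: bounded_ops_add bounded_ops_scale ell2.scale_right_distrib mult.commute)
  moreover have "has_matrix ?S (schur_product (\<lambda>i j. l * M i j) (matrix_of T))"
    using S(2) by (simp add: has_matrix_def matrix_of_def schur_product_def scaleC_ell2.rep_eq)
  moreover have "onorm ?S \<le> (cmod l * C) * onorm T"
  proof -
    have "onorm ?S \<le> cmod l * onorm S"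
      using bounded_ops_onorm_nonneg[OF S(1)] by (intro onorm_bound le) simp
    then show ?thesis using mult_left_mono[OF S(3) norm_ge_zero[of l]] by (simp add: mult.assoc)
  qed
  ultimately show "\<exists>S\<in>bounded_ops.
      has_matrix S (schur_product (\<lambda>i j. l * M i j) (matrix_of T)) \<and> onorm S \<le> cmod l * C * onorm T"
    by blast
qed

lemma schur_norm_le_add:
  assumes "schur_norm_le M C" "schur_norm_le M' C'"
  shows "schur_norm_le (\<lambda>i j. M i j + M' i j) (C + C')"
  unfolding schur_norm_le_def
proof
  fix T assume T: "T \<in> bounded_ops"
  with assms(1) obtain S where S: "S \<in> bounded_ops" "has_matrix S (schur_product M (matrix_of T))"
    "onorm S \<le> C * onorm T" unfolding schur_norm_le_def by blast
  from T assms(2) obtain S' where S': "S' \<in> bounded_ops"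
    "has_matrix S' (schur_product M' (matrix_of T))"
    "onorm S' \<le> C' * onorm T" unfolding schur_norm_le_def by blast
  let ?S = "\<lambda>x. S x + S' x"
  have le: "norm (?S x) \<le> (onorm S + onorm S') * norm x" for x
    using norm_triangle_ineq[of "S x" "S' x"] bounded_ops_onorm[OF S(1), of x]
      bounded_ops_onorm[OF S'(1), of x] by (simp add: distrib_right)
  have "?S \<in> bounded_ops"
    using S(1) S'(1) by (intro bounded_opsI[OF _ _ le])
      (simp_all add: bounded_ops_add bounded_ops_scale ell2.scale_right_distrib)
  moreover have "has_matrix ?S (schur_product (\<lambda>i j. M i j + M' i j) (matrix_of T))"
    using S(2) S'(2)
    by (simp add: has_matrix_def matrix_of_def schur_product_def plus_ell2.rep_eq distrib_right)
  moreover have "onorm ?S \<le> (C + C') * onorm T"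
  proof -
    have "onorm ?S \<le> onorm S + onorm S'"
      using bounded_ops_onorm_nonneg[OF S(1)] bounded_ops_onorm_nonneg[OF S'(1)]
      by (intro onorm_bound le) simp
    then show ?thesis using S(3) S'(3) by (simp add: distrib_right)
  qed
  ultimately show "\<exists>S\<in>bounded_ops.
      has_matrix S (schur_product (\<lambda>i j. M i j + M' i j) (matrix_of T)) \<and>
      onorm S \<le> (C + C') * onorm T"
    by blast
qed

lemma schur_norm_le_zero: "schur_norm_le (\<lambda>i j. 0) 0"
  using schur_norm_le_scale[OF schur_norm_le_rank_one[of "\<lambda>_. 0" "\<lambda>_. 0"], of 0] by simp

lemma schur_norm_le_sum:
  assumes "\<And>q. q \<in> Q \<Longrightarrow> schur_norm_le (M q) (C q)"
  shows "schur_norm_le (\<lambda>i j. \<Sum>q\<in>Q. M q i j) (\<Sum>q\<in>Q. C q)"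
  using assms
  by (induction Q rule: infinite_finite_induct)
    (simp_all add: schur_norm_le_zero schur_norm_le_add)

text \<open>Fatou property of the Schur norm.\<close>

lemma schur_norm_le_limit:
  assumes M: "\<And>N. schur_norm_le (M N) C"
    and lim: "\<And>i j. i \<ge> 1 \<Longrightarrow> j \<ge> 1 \<Longrightarrow> (\<lambda>N. M N i j) \<longlonglongrightarrow> L i j"
  shows "schur_norm_le L C"
  unfolding schur_norm_le_def
proof
  fix T assume T: "T \<in> bounded_ops"
  have "\<forall>N. \<exists>S. S \<in> bounded_ops \<and> has_matrix S (schur_product (M N) (matrix_of T)) \<and>
      onorm S \<le> C * onorm T"
    using M T unfolding schur_norm_le_def by blast
  then obtain S where S: "\<And>N. S N \<in> bounded_ops"
    "\<And>N. has_matrix (S N) (schur_product (M N) (matrix_of T))"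
    "\<And>N. onorm (S N) \<le> C * onorm T"
    by metis
  have "(\<lambda>N. matrix_of (S N) i j) \<longlonglongrightarrow> schur_product L (matrix_of T) i j"
    if "i \<ge> 1" "j \<ge> 1" for i j
  proof -
    have "(\<lambda>N. M N i j * matrix_of T i j) \<longlonglongrightarrow> L i j * matrix_of T i j"
      by (intro tendsto_intros lim that)
    then show ?thesis
      using S(2) that by (simp add: has_matrix_def schur_product_def)
  qed
  from pointwise_limit_operator[OF S(1,3) this] obtain R where "R \<in> bounded_ops"
    "has_matrix R (schur_product L (matrix_of T))" "onorm R \<le> C * onorm T" .
  then show "\<exists>S\<in>bounded_ops. has_matrix S (schur_product L (matrix_of T)) \<and> onorm S \<le> C * onorm T"
    by blast
qed

section \<open>Hankel ramps and second differences\<close>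

text \<open>Writing the ramp as a count of integers strictly above \<open>i\<close> and at most \<open>m + 1 - j\<close> separates
  the two indices: each \<open>t\<close> imposes one condition on \<open>i\<close> and one on \<open>j\<close>.\<close>

lemma ramp_eq_card:
  fixes i j m :: nat
  assumes "1 \<le> j"
  shows "card {t \<in> {1..m}. i < t \<and> t + j \<le> m + 1} = m + 1 - (i + j)"
proof -
  have "{t \<in> {1..m}. i < t \<and> t + j \<le> m + 1} = {i<..m + 1 - j}"
    using assms by auto
  then show ?thesis by (simp del: One_nat_def)
qed

text \<open>By \<open>ramp_eq_card\<close> the ramp \<open>(m + 1 - (i + j))\<^sub>+\<close> is a sum of \<open>m\<close> products
  \<open>u\<^sub>t(i) v\<^sub>t(j)\<close> of indicators. On their supports \<open>i\<close> and \<open>j\<close> are at most \<open>m\<close>, so each of the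
  factors \<open>j\<close> and \<open>i\<close> in \<open>j - i\<close> can be absorbed into one indicator at the cost of a
  constant \<open>m\<close>. Nothing is lost by treating \<open>j\<close> and \<open>i\<close> separately: only the order
  \<open>m\<^sup>2\<close> matters below.\<close>

lemma schur_norm_le_weighted_ramp:
  "schur_norm_le (\<lambda>i j. of_real ((real j - real i) * real (m + 1 - (i + j)))) (2 * real m * real m)"
proof -
  define u :: "nat \<Rightarrow> nat \<Rightarrow> complex" where "u t i = (if i < t then 1 else 0)" for t i
  define v :: "nat \<Rightarrow> nat \<Rightarrow> complex"
    where "v t j = (if t + j \<le> m + 1 then 1 else 0)" for t j
  let ?R = "\<lambda>t i j. u t i * (v t j * of_real (real j / m)) +
      (- 1) * (u t i * of_real (real i / m) * v t j)"
  have "schur_norm_le (?R t) (1 + cmod (- 1) * 1)" if "t \<in> {1..m}" for t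
    using that
    by (intro schur_norm_le_add schur_norm_le_scale schur_norm_le_rank_one)
      (auto simp: u_def v_def simp del: of_real_divide)
  then have "schur_norm_le (\<lambda>i j. of_real m * (\<Sum>t\<in>{1..m}. ?R t i j))
      (cmod (of_real m) * (\<Sum>t\<in>{1..m}. 1 + cmod (- 1) * 1))"
    by (intro schur_norm_le_scale schur_norm_le_sum)
  then have *: "schur_norm_le (\<lambda>i j. of_real m * (\<Sum>t\<in>{1..m}. ?R t i j)) (2 * real m * real m)"
    by (simp add: mult_ac)
  show ?thesis
  proof (rule schur_norm_le_cong[OF *])
    fix i j :: nat assume "1 \<le> i" and j: "1 \<le> j"
    have "(\<Sum>t\<in>{1..m}. u t i * v t j) =
        (\<Sum>t\<in>{1..m}. if i < t \<and> t + j \<le> m + 1 then 1 else 0)"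
      by (rule sum.cong) (auto simp: u_def v_def)
    also have "\<dots> = of_nat (m + 1 - (i + j))"
      using ramp_eq_card[OF j, of m i] by (simp add: sum.If_cases Int_def)
    finally have uv: "(\<Sum>t\<in>{1..m}. u t i * v t j) = of_nat (m + 1 - (i + j))" .
    have "of_real m * (\<Sum>t\<in>{1..m}. ?R t i j) =
        of_real m * (of_real ((real j - real i) / m) * (\<Sum>t\<in>{1..m}. u t i * v t j))"
      unfolding sum_distrib_left
      by (intro sum.cong refl) (simp add: diff_divide_distrib algebra_simps)
    also have "\<dots> = of_real ((real j - real i) * real (m + 1 - (i + j)))"
      unfolding uv using j by (cases "m = 0") simp_all
    finally show "of_real m * (\<Sum>t\<in>{1..m}. ?R t i j) =
        of_real ((real j - real i) * real (m + 1 - (i + j)))" .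
  qed
qed

lemma sum_second_difference:
  fixes d :: "nat \<Rightarrow> real"
  assumes "1 \<le> n" "n \<le> N"
  shows "(\<Sum>m\<in>{1..<N}. (d m - 2 * d (m + 1) + d (m + 2)) * real (m + 1 - n)) =
    d n - d N - (real N - real n) * (d N - d (N + 1))"
  using assms(2)
proof (induction N rule: dec_induct)
  case base
  then show ?case by (auto intro!: sum.neutral)
next
  case (step N)
  then show ?case using assms(1) by (simp add: algebra_simps of_nat_diff)
qed

text \<open>The boundary terms of the double summation by parts are \<open>d\<^sub>N\<close> and
  \<open>(N - n) (d\<^sub>N - d\<^sub>N\<^sub>+\<^sub>1)\<close>; the growth condition on \<open>d\<close> makes both vanish in the limit.\<close>

lemma sum_second_difference_tendsto:
  fixes d :: "nat \<Rightarrow> real"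
  assumes "1 \<le> n" and lim: "(\<lambda>N. real N * d N) \<longlonglongrightarrow> 0"
  shows "(\<lambda>N. \<Sum>m\<in>{1..<N}. (d m - 2 * d (m + 1) + d (m + 2)) * real (m + 1 - n)) \<longlonglongrightarrow> d n"
proof -
  have d0: "d \<longlonglongrightarrow> 0"
  proof -
    have "(\<lambda>N. (1 / real N) * (real N * d N)) \<longlonglongrightarrow> 0 * 0"
      by (intro tendsto_mult lim lim_1_over_n)
    then show ?thesis
      by (rule filterlim_cong[THEN iffD1, rotated -1])
        (auto simp: eventually_sequentially intro!: exI[of _ 1])
  qed
  have d1: "(\<lambda>N. d (N + 1)) \<longlonglongrightarrow> 0"
    using LIMSEQ_ignore_initial_segment[OF d0, of 1] .
  have Nd1: "(\<lambda>N. real (N + 1) * d (N + 1)) \<longlonglongrightarrow> 0"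
    using LIMSEQ_ignore_initial_segment[OF lim, of 1] .
  have "(\<lambda>N. d n - d N - ((real N * d N - (real (N + 1) * d (N + 1) - d (N + 1))) - real n * (d N - d (N + 1))))
      \<longlonglongrightarrow> d n - 0 - ((0 - (0 - 0)) - real n * (0 - 0))"
    by (intro tendsto_intros d0 d1 Nd1 lim)
  then have L: "(\<lambda>N. d n - d N - (real N - real n) * (d N - d (N + 1))) \<longlonglongrightarrow> d n"
    by (simp add: algebra_simps)
  show ?thesis
    by (rule filterlim_cong[THEN iffD1, OF refl refl _ L])
      (use sum_second_difference[OF assms(1)] in \<open>auto simp: eventually_sequentially intro!: exI[of _ n]\<close>)
qed

text \<open>Expanding \<open>d\<close> in ramps gives the matrix as the entrywise limit of
  \<open>\<Sum>m. e\<^sub>m (j - i) (m + 1 - (i + j))\<^sub>+\<close>, where \<open>e\<close> is the second difference of \<open>d\<close>. The term with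
  index \<open>m\<close> costs at most \<open>2 m\<^sup>2 \<bar>e\<^sub>m\<bar>\<close>, which is why the weight \<open>n\<^sup>2\<close> appears in the hypothesis.\<close>

lemma schur_multiplier_of_second_difference:
  fixes d :: "nat \<Rightarrow> real"
  assumes lim: "(\<lambda>n. real n * d n) \<longlonglongrightarrow> 0"
    and sm: "(\<lambda>n. (real n)\<^sup>2 * \<bar>d n - 2 * d (n + 1) + d (n + 2)\<bar>) summable_on {1..}"
  shows "schur_multiplier (\<lambda>i j. of_real ((real j - real i) * d (i + j)))"
proof -
  define e where "e m = d m - 2 * d (m + 1) + d (m + 2)" for m
  let ?K = "\<lambda>m i j. of_real ((real j - real i) * real (m + 1 - (i + j))) :: complex"
  define C where "C = 2 * (\<Sum>\<^sub>\<infinity>n\<in>{1..}. (real n)\<^sup>2 * \<bar>e n\<bar>)"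
  have part: "schur_norm_le (\<lambda>i j. \<Sum>m\<in>{1..<N}. of_real (e m) * ?K m i j) C" for N
  proof (rule schur_norm_le_mono)
    show "schur_norm_le (\<lambda>i j. \<Sum>m\<in>{1..<N}. of_real (e m) * ?K m i j)
        (\<Sum>m\<in>{1..<N}. cmod (of_real (e m)) * (2 * real m * real m))"
      by (intro schur_norm_le_sum schur_norm_le_scale schur_norm_le_weighted_ramp)
    have "(\<Sum>m\<in>{1..<N}. (real m)\<^sup>2 * \<bar>e m\<bar>) \<le> (\<Sum>\<^sub>\<infinity>n\<in>{1..}. (real n)\<^sup>2 * \<bar>e n\<bar>)"
      using sm by (intro finite_sum_le_infsum) (auto simp: e_def)
    moreover have "(\<Sum>m\<in>{1..<N}. cmod (of_real (e m)) * (2 * real m * real m)) =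
        2 * (\<Sum>m\<in>{1..<N}. (real m)\<^sup>2 * \<bar>e m\<bar>)"
      unfolding sum_distrib_left by (rule sum.cong) (simp_all add: power2_eq_square mult_ac)
    ultimately show "(\<Sum>m\<in>{1..<N}. cmod (of_real (e m)) * (2 * real m * real m)) \<le> C"
      by (simp add: C_def)
  qed
  have "schur_norm_le (\<lambda>i j. of_real ((real j - real i) * d (i + j))) C"
  proof (rule schur_norm_le_limit[OF part])
    fix i j :: nat assume "1 \<le> i" "1 \<le> j"
    then have "(\<lambda>N. (real j - real i) * (\<Sum>m\<in>{1..<N}. e m * real (m + 1 - (i + j))))
        \<longlonglongrightarrow> (real j - real i) * d (i + j)"
      unfolding e_def by (intro tendsto_mult_left sum_second_difference_tendsto lim) simp
    then have "(\<lambda>N. complex_of_real ((real j - real i) * (\<Sum>m\<in>{1..<N}. e m * real (m + 1 - (i + j)))))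
        \<longlonglongrightarrow> of_real ((real j - real i) * d (i + j))"
      by (rule tendsto_of_real)
    then show "(\<lambda>N. \<Sum>m\<in>{1..<N}. of_real (e m) * ?K m i j)
        \<longlonglongrightarrow> of_real ((real j - real i) * d (i + j))"
      by (simp add: sum_distrib_left mult_ac)
  qed
  then show ?thesis by (rule schur_norm_le_imp_multiplier)
qed

text \<open>Here \<open>x\<close>, \<open>x - b\<close> and \<open>x - 2 b + c\<close> are three consecutive terms of a sequence with first
  difference \<open>b\<close> and second difference \<open>c\<close>. The product rule for the second difference of the
  sequence divided by \<open>n + 1\<close> has three terms, one for each of \<open>x\<close>, \<open>b\<close> and \<open>c\<close>, and
  they decay like \<open>n\<^sup>-\<^sup>3\<close>, \<open>n\<^sup>-\<^sup>2\<close> and \<open>n\<^sup>-\<^sup>1\<close>.\<close>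

lemma second_difference_quotient_le:
  fixes x b c :: real
  assumes "n \<ge> 1"
  shows "(real n)\<^sup>2 * \<bar>x / real (n + 1) - 2 * (x - b) / real (n + 2) + (x - 2 * b + c) / real (n + 3)\<bar>
     \<le> 2 * \<bar>x / real n\<bar> + 2 * \<bar>b\<bar> + \<bar>real n * c\<bar>"
proof -
  define r where "r = real n"
  have r: "r \<ge> 1" using assms by (simp add: r_def)
  have "x / (r + 1) - 2 * (x - b) / (r + 2) + (x - 2 * b + c) / (r + 3) =
      2 * x / ((r + 1) * (r + 2) * (r + 3)) + 2 * b / ((r + 2) * (r + 3)) + c / (r + 3)"
    using r by (simp add: divide_simps) (simp add: algebra_simps)
  then have "r\<^sup>2 * \<bar>x / (r + 1) - 2 * (x - b) / (r + 2) + (x - 2 * b + c) / (r + 3)\<bar> \<le>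
      r\<^sup>2 * (2 * \<bar>x\<bar> / ((r + 1) * (r + 2) * (r + 3)) + 2 * \<bar>b\<bar> / ((r + 2) * (r + 3)) + \<bar>c\<bar> / (r + 3))"
    using r by (intro mult_left_mono) (auto intro!: order_trans[OF abs_triangle_ineq] add_mono simp: abs_mult)
  also have "\<dots> = (r\<^sup>2 / ((r + 1) * (r + 2) * (r + 3))) * (2 * \<bar>x\<bar>) +
      (r\<^sup>2 / ((r + 2) * (r + 3))) * (2 * \<bar>b\<bar>) + (r\<^sup>2 / (r + 3)) * \<bar>c\<bar>"
    by (simp add: algebra_simps)
  also have "\<dots> \<le> (1 / r) * (2 * \<bar>x\<bar>) + 1 * (2 * \<bar>b\<bar>) + r * \<bar>c\<bar>"
  proof (intro add_mono mult_right_mono)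
    show "r\<^sup>2 / ((r + 1) * (r + 2) * (r + 3)) \<le> 1 / r"
      using r by (simp add: divide_simps) (simp add: power2_eq_square algebra_simps)
    show "r\<^sup>2 / ((r + 2) * (r + 3)) \<le> 1" "r\<^sup>2 / (r + 3) \<le> r"
      using r by (simp_all add: divide_simps) (simp_all add: power2_eq_square algebra_simps)
  qed auto
  also have "\<dots> = 2 * \<bar>x / r\<bar> + 2 * \<bar>b\<bar> + \<bar>r * c\<bar>"
    using r by (simp add: abs_mult)
  finally show ?thesis by (simp add: r_def add_ac)
qed

theorem theorem3p1:
  fixes a b c :: "nat \<Rightarrow> real"
  assumes "a \<longlonglongrightarrow> 0"
    and "\<And>n. n \<ge> 1 \<Longrightarrow> b n = a n - a (n + 1)"
    and "\<And>n. n \<ge> 1 \<Longrightarrow> c n = a n - 2 * a (n + 1) + a (n + 2)"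
    and "(\<lambda>n. \<bar>a n / real n\<bar>) summable_on {1..}"
    and "(\<lambda>n. \<bar>b n\<bar>) summable_on {1..}"
    and "(\<lambda>n. \<bar>real n * c n\<bar>) summable_on {1..}"
  shows "schur_multiplier
    (\<lambda>i j. complex_of_real ((real j - real i) * a (i + j) / real (i + j + 1)))"
proof -
  define d where "d n = a n / real (n + 1)" for n
  have "(\<lambda>n. real n * d n) \<longlonglongrightarrow> 0"
  proof -
    have "(\<lambda>n. real n / real (Suc n) * a n) \<longlonglongrightarrow> 1 * 0"
      by (intro tendsto_mult LIMSEQ_n_over_Suc_n assms(1))
    then show ?thesis by (simp add: d_def)
  qed
  moreover have "(\<lambda>n. (real n)\<^sup>2 * \<bar>d n - 2 * d (n + 1) + d (n + 2)\<bar>) summable_on {1..}"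
  proof (rule summable_on_comparison_test)
    show "(\<lambda>n. 2 * \<bar>a n / real n\<bar> + 2 * \<bar>b n\<bar> + \<bar>real n * c n\<bar>) summable_on {1..}"
      by (intro summable_on_add summable_on_cmult_right assms)
    fix n :: nat assume "n \<in> {1..}"
    then have n: "n \<ge> 1" by simp
    have "a (n + 1) = a n - b n" "a (n + 2) = a n - 2 * b n + c n"
      using assms(2,3)[OF n] by simp_all
    then show "(real n)\<^sup>2 * \<bar>d n - 2 * d (n + 1) + d (n + 2)\<bar> \<le>
        2 * \<bar>a n / real n\<bar> + 2 * \<bar>b n\<bar> + \<bar>real n * c n\<bar>"
      using second_difference_quotient_le[OF n, of "a n" "b n" "c n"]
      by (simp add: d_def add_ac numeral_3_eq_3)
  qed simp
  ultimately show ?thesis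
    using schur_multiplier_of_second_difference[of d] by (simp add: d_def)
qed

end
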